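(* Let $F:\mathbb{R}^2\to\mathbb{R}$ be periodic with period $1$ in $t$, and suppose that the firing map $\Phi$ arising from the integrate-and-fire system $\dot{x}=F(t,x)$ is a $C^1$-diffeomorphism (a lift of an orientation preserving circle diffeomorphism) with irrational rotation number $\varrho$, conjugated with the translation by $\varrho$ via a $C^1$-diffeomorphism $\Gamma$. Let $\Psi(t)=\Phi(t)-t$ and suppose that the set $\mathcal{C}_\Psi\subset[0,1]$ of critical points of $\Psi|_{[0,1]}$ has Lebesgue measure $0$. Then the interspike-interval distribution $\mu_{\mathrm{ISI}}$ is absolutely continuous with respect to Lebesgue measure, with density $$\Delta(y)=\begin{cases}0,& y\notin\operatorname{supp}(\mu_{\mathrm{ISI}}),\\[2pt] \displaystyle\sum_{t\in\Psi^{-1}(y)}\Gamma'(t)\,\frac{1}{|\Phi'(t)-1|},& y\in\operatorname{supp}(\mu_{\mathrm{ISI}}),\end{cases}$$ where $\Psi^{-1}(y)$ denotes the preimage under $\Psi|_{[0,1]}$ and the latter expression is well-defined almost everywhere in $\operatorname{supp}(\mu_{\mathrm{ISI}})$, namely on $\operatorname{supp}(\mu_{\mathrm{ISI}})\setminus V(\mathcal{C}_\Psi)$, where $V(\mathcal{C}_\Psi)=\Psi(\mathcal{C}_\Psi)$ is the set of critical values of $\Psi|_{[0,1]}$.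
   Context: For $\dot{x}=F(t,x)$ (with existence and uniqueness of solutions), the firing map is $\Phi(t):=\inf\{s>t: x(s;t,0)\ge1\}$, where $x(\cdot;t,0)$ is the solution with $x(t)=0$ (reset value $0$, threshold $1$). $1$-periodicity of $F$ in $t$ gives $\Phi(t+1)=\Phi(t)+1$, so $\Phi$ is a lift of a circle map $\varphi$ under $t\mapsto e^{2\pi it}$. The rotation number is $\varrho=\lim_n\Phi^n(t)/n$. Conjugated with the translation via $\Gamma$ means $\Gamma(\Phi(t))=\Gamma(t)+\varrho$, where $\Gamma:\mathbb{R}\to\mathbb{R}$ is an increasing $C^1$-diffeomorphism with $\Gamma(t+1)=\Gamma(t)+1$. With $\mu$ the unique invariant Borel probability measure of $\varphi$, regarded on $[0,1]$ (with endpoints identified), $\mu_{\mathrm{ISI}}(A):=\mu(\{t\in[0,1]:\Phi(t)-t\in A\})$ for Borel $A\subset\mathbb{R}$. *)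

theory Defs
  imports "HOL-Analysis.Analysis"
begin

section \<open>Integrate-and-fire systems and their firing map\<close>

definition ivp_solution ::
    "(real \<Rightarrow> real \<Rightarrow> real) \<Rightarrow> real \<Rightarrow> real \<Rightarrow> real set \<Rightarrow> (real \<Rightarrow> real) \<Rightarrow> bool" where
  "ivp_solution F t0 x0 J x \<longleftrightarrow>
     open J \<and> is_interval J \<and> t0 \<in> J \<and> x t0 = x0 \<and>
     (\<forall>s\<in>J. (x has_real_derivative F s (x s)) (at s))"

definition well_posed :: "(real \<Rightarrow> real \<Rightarrow> real) \<Rightarrow> bool" where
  "well_posed F \<longleftrightarrow>
     (\<forall>t0 x0. \<exists>J x. ivp_solution F t0 x0 J x) \<and>
     (\<forall>t0 x0 J x y. ivp_solution F t0 x0 J x \<longrightarrow> ivp_solution F t0 x0 J y \<longrightarrow> (\<forall>s\<in>J. x s = y s))"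

text \<open>Solutions may blow up in finite time, so \<open>x(\<cdot>; t0, x0)\<close> is the maximal solution,
  living on the maximal interval of existence.\<close>

definition ivp_domain :: "(real \<Rightarrow> real \<Rightarrow> real) \<Rightarrow> real \<Rightarrow> real \<Rightarrow> real set" where
  "ivp_domain F t0 x0 = \<Union>{J. \<exists>x. ivp_solution F t0 x0 J x}"

definition ivp_sol :: "(real \<Rightarrow> real \<Rightarrow> real) \<Rightarrow> real \<Rightarrow> real \<Rightarrow> real \<Rightarrow> real" where
  "ivp_sol F t0 x0 s = (THE v. \<exists>J x. ivp_solution F t0 x0 J x \<and> s \<in> J \<and> v = x s)"

definition firing_times :: "(real \<Rightarrow> real \<Rightarrow> real) \<Rightarrow> real \<Rightarrow> real set" where
  "firing_times F t = {s. t < s \<and> s \<in> ivp_domain F t 0 \<and> 1 \<le> ivp_sol F t 0 s}"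

text \<open>Only meaningful at \<open>t\<close> if \<open>firing_times F t\<close> is nonempty: \<open>Inf {}\<close> is an
  unspecified real number.\<close>

definition firing_map :: "(real \<Rightarrow> real \<Rightarrow> real) \<Rightarrow> real \<Rightarrow> real" where
  "firing_map F t = Inf (firing_times F t)"


section \<open>Lifts of circle diffeomorphisms\<close>

definition lift_circle_diffeo :: "(real \<Rightarrow> real) \<Rightarrow> bool" where
  "lift_circle_diffeo f \<longleftrightarrow>
     strict_mono f \<and> bij f \<and> f C1_differentiable_on UNIV \<and> inv f C1_differentiable_on UNIV \<and>
     (\<forall>t. f (t + 1) = f t + 1)"

definition has_rotation_number :: "(real \<Rightarrow> real) \<Rightarrow> real \<Rightarrow> bool" where
  "has_rotation_number f \<rho> \<longleftrightarrow> (\<forall>t. (\<lambda>n. (f ^^ n) t / real n) \<longlonglongrightarrow> \<rho>)"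

definition conjugated_with_translation_via ::
    "(real \<Rightarrow> real) \<Rightarrow> real \<Rightarrow> (real \<Rightarrow> real) \<Rightarrow> bool" where
  "conjugated_with_translation_via f \<rho> \<Gamma> \<longleftrightarrow>
     lift_circle_diffeo \<Gamma> \<and> (\<forall>t. \<Gamma> (f t) = \<Gamma> t + \<rho>)"

text \<open>The covering map \<open>t \<mapsto> e\<^sup>2\<^sup>\<pi>\<^sup>i\<^sup>t\<close> of the unit circle.\<close>

definition circle_cover :: "real \<Rightarrow> complex" where
  "circle_cover t = cis (2 * pi * t)"

text \<open>The circle map with lift \<open>f\<close>, i.e. \<open>circle_map f \<circ> circle_cover = circle_cover \<circ> f\<close>;
  see \<open>circle_map_circle_cover\<close> below.\<close>

definition circle_map :: "(real \<Rightarrow> real) \<Rightarrow> complex \<Rightarrow> complex" where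
  "circle_map f z = circle_cover (f (Arg2pi z / (2 * pi)))"

definition circle_borel :: "complex measure" where
  "circle_borel = restrict_space borel (sphere 0 1)"

definition invariant_prob :: "(complex \<Rightarrow> complex) \<Rightarrow> complex measure \<Rightarrow> bool" where
  "invariant_prob \<phi> \<mu> \<longleftrightarrow>
     sets \<mu> = sets circle_borel \<and> emeasure \<mu> (space \<mu>) = 1 \<and>
     \<phi> \<in> measurable \<mu> \<mu> \<and> distr \<mu> \<mu> \<phi> = \<mu>"


section \<open>The interspike-interval distribution\<close>

definition displacement :: "(real \<Rightarrow> real) \<Rightarrow> real \<Rightarrow> real" where
  "displacement f t = f t - t"

text \<open>The image under \<open>circle_cover\<close> transfers subsets of \<open>[0,1]\<close>, with endpoints identified,
  to the circle. This set function is indeed a measure, see \<open>emeasure_isi_distribution\<close> below.\<close>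

definition isi_distribution :: "(real \<Rightarrow> real) \<Rightarrow> complex measure \<Rightarrow> real measure" where
  "isi_distribution f \<mu> = measure_of UNIV (sets borel)
     (\<lambda>A. emeasure \<mu> (circle_cover ` {t \<in> {0..1}. displacement f t \<in> A}))"

definition measure_support :: "'a::topological_space measure \<Rightarrow> 'a set" where
  "measure_support \<nu> = {y. \<forall>U. open U \<longrightarrow> y \<in> U \<longrightarrow> 0 < emeasure \<nu> U}"

text \<open>At the endpoints, the one-sided derivatives of the restriction to \<open>[0,1]\<close> agree with the
  two-sided derivative of the displacement on the real line.\<close>

definition critical_points :: "(real \<Rightarrow> real) \<Rightarrow> real set" where
  "critical_points f = {t \<in> {0..1}. deriv (displacement f) t = 0}"

definition critical_values :: "(real \<Rightarrow> real) \<Rightarrow> real set" where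
  "critical_values f = displacement f ` critical_points f"

definition displacement_preimage :: "(real \<Rightarrow> real) \<Rightarrow> real \<Rightarrow> real set" where
  "displacement_preimage f y = {t \<in> {0..1}. displacement f t = y}"

text \<open>At critical values in the support the sum is not well-defined; there the value is set to
  \<open>0\<close>.\<close>

definition isi_density ::
    "(real \<Rightarrow> real) \<Rightarrow> (real \<Rightarrow> real) \<Rightarrow> complex measure \<Rightarrow> real \<Rightarrow> real" where
  "isi_density f \<Gamma> \<mu> y =
     (if y \<notin> measure_support (isi_distribution f \<mu>) then 0
      else if y \<in> critical_values f then 0
      else (\<Sum>t\<in>displacement_preimage f y. deriv \<Gamma> t * (1 / \<bar>deriv f t - 1\<bar>)))"


section \<open>Consistency of the definitions\<close>

lemma circle_cover_add_int: "circle_cover (t + of_int k) = circle_cover t"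
proof -
  have "circle_cover (t + of_int k) = cis (2 * pi * t) * cis (2 * pi * of_int k)"
    unfolding circle_cover_def cis_mult by (simp only: distrib_left)
  also have "cis (2 * pi * of_int k) = 1"
    by (rule cis_multiple_2pi) simp
  finally show ?thesis
    by (simp add: circle_cover_def)
qed

lemma Arg2pi_circle_cover: "Arg2pi (circle_cover t) = 2 * pi * frac t"
proof -
  have "circle_cover t = circle_cover (frac t + of_int \<lfloor>t\<rfloor>)"
    by (simp add: frac_def)
  then have "circle_cover t = circle_cover (frac t)"
    by (simp only: circle_cover_add_int)
  then have "of_real 1 * exp (\<i> * of_real (2 * pi * frac t)) = circle_cover t"
    by (simp add: circle_cover_def cis_conv_exp)
  then show ?thesis
    by (rule Arg2pi_unique) (use frac_lt_1[of t] frac_ge_0[of t] in simp_all)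
qed

lemma lift_add_nat:
  assumes "\<And>t. f (t + 1) = f t + (1::real)"
  shows "f (t + of_nat n) = f t + of_nat n"
proof (induction n)
  case (Suc n)
  have "f (t + of_nat (Suc n)) = f ((t + of_nat n) + 1)"
    by (simp add: algebra_simps)
  then show ?case
    unfolding assms Suc by simp
qed simp

lemma lift_add_int:
  assumes "\<And>t. f (t + 1) = f t + (1::real)"
  shows "f (t + of_int k) = f t + of_int k"
proof (cases k)
  case (nonneg n)
  then show ?thesis by (simp add: lift_add_nat[of f, OF assms])
next
  case (neg n)
  then have "f ((t + of_int k) + of_nat (Suc n)) = f t"
    by simp
  then show ?thesis
    unfolding lift_add_nat[of f, OF assms] using neg by simp
qed

lemma circle_map_circle_cover:
  assumes "\<And>t. f (t + 1) = f t + 1"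
  shows "circle_map f (circle_cover t) = circle_cover (f t)"
proof -
  have "circle_map f (circle_cover t) = circle_cover (f (frac t))"
    by (simp add: circle_map_def Arg2pi_circle_cover)
  also have "\<dots> = circle_cover (f (frac t) + of_int \<lfloor>t\<rfloor>)"
    by (simp only: circle_cover_add_int)
  also have "f (frac t) + of_int \<lfloor>t\<rfloor> = f (frac t + of_int \<lfloor>t\<rfloor>)"
    by (simp only: lift_add_int[of f, OF assms])
  also have "frac t + of_int \<lfloor>t\<rfloor> = t"
    by (simp add: frac_def)
  finally show ?thesis .
qed

lemma circle_cover_image_displacement:
  assumes "\<And>t. f (t + 1) = f t + 1"
  shows "circle_cover ` {t \<in> {0..1}. displacement f t \<in> A} =
         (\<lambda>z. displacement f (Arg2pi z / (2 * pi))) -` A \<inter> sphere 0 1"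
proof (intro equalityI subsetI)
  fix z assume "z \<in> circle_cover ` {t \<in> {0..1}. displacement f t \<in> A}"
  then obtain t where t: "z = circle_cover t" "displacement f t \<in> A"
    by auto
  have "f t = f (frac t + of_int \<lfloor>t\<rfloor>)"
    by (simp add: frac_def)
  also have "\<dots> = f (frac t) + of_int \<lfloor>t\<rfloor>"
    by (rule lift_add_int[of f, OF assms])
  finally have "displacement f (frac t) = displacement f t"
    by (simp add: displacement_def frac_def)
  moreover have "norm z = 1"
    by (simp add: t circle_cover_def)
  ultimately show "z \<in> (\<lambda>z. displacement f (Arg2pi z / (2 * pi))) -` A \<inter> sphere 0 1"
    using t by (simp add: Arg2pi_circle_cover)
next
  fix z assume z: "z \<in> (\<lambda>z. displacement f (Arg2pi z / (2 * pi))) -` A \<inter> sphere 0 1"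
  then have "exp (\<i> * of_real (Arg2pi z)) = z"
    using complex_norm_eq_1_exp[of z] by simp
  then have "z = circle_cover (Arg2pi z / (2 * pi))"
    by (simp add: circle_cover_def cis_conv_exp)
  moreover have "Arg2pi z / (2 * pi) \<in> {0..1}"
    using Arg2pi[of z] by (auto simp: field_simps)
  ultimately show "z \<in> circle_cover ` {t \<in> {0..1}. displacement f t \<in> A}"
    using z by auto
qed

lemma emeasure_isi_distribution:
  assumes f: "lift_circle_diffeo f" and \<mu>: "sets \<mu> = sets circle_borel" and A: "A \<in> sets borel"
  shows "emeasure (isi_distribution f \<mu>) A =
         emeasure \<mu> (circle_cover ` {t \<in> {0..1}. displacement f t \<in> A})"
proof -
  define g where "g = (\<lambda>z. displacement f (Arg2pi z / (2 * pi)))"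
  have lift: "\<And>t. f (t + 1) = f t + 1"
    using f by (simp add: lift_circle_diffeo_def)
  have [measurable]: "Arg2pi \<in> borel_measurable borel"
    unfolding borel_measurable_iff_greater by (simp add: open_Arg2pi2pi_gt)
  have "continuous_on UNIV f"
    using f by (auto simp: lift_circle_diffeo_def intro: C1_differentiable_imp_continuous_on)
  then have [measurable]: "f \<in> borel_measurable borel"
    by (rule borel_measurable_continuous_onI)
  have "g \<in> borel_measurable borel"
    unfolding g_def displacement_def by measurable
  then have g: "g \<in> borel_measurable \<mu>"
    unfolding measurable_cong_sets[OF \<mu> refl] circle_borel_def by (rule measurable_restrict_space1)
  have space: "space \<mu> = sphere 0 1"
    using sets_eq_imp_space_eq[OF \<mu>] by (simp add: circle_borel_def space_restrict_space)
  have "isi_distribution f \<mu> = distr \<mu> borel g"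
    unfolding isi_distribution_def distr_def circle_cover_image_displacement[of f, OF lift]
    by (simp add: space g_def)
  then have "emeasure (isi_distribution f \<mu>) A = emeasure \<mu> (g -` A \<inter> sphere 0 1)"
    using A g by (simp add: emeasure_distr space)
  then show ?thesis
    by (simp only: circle_cover_image_displacement[of f, OF lift] g_def)
qed

end

theory Submission
  imports Defs
begin

text \<open>The distribution function of \<open>\<mu>\<close>, extended to a lift \<open>G\<close> of degree one, satisfies
  \<open>G (\<Phi> t) = G t + c\<close> by invariance. Hence \<open>G \<circ> \<Gamma>\<inverse>\<close> is monotone and commutes with the translation by
  \<open>\<rho>\<close> up to a constant, so irrationality of \<open>\<rho>\<close> forces it to be a translation: on \<open>[0,1)\<close> the measure
  \<open>\<mu>\<close> has density \<open>\<Gamma>'\<close>. The interspike-interval distribution is therefore the image of \<open>\<Gamma>' dt\<close> under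
  \<open>\<Psi>\<close>, and the one-dimensional area formula off the null set of critical points gives its density. The
  critical values are null as the image of a null set under a \<open>C\<^sup>1\<close> map.\<close>

section \<open>The one-dimensional area formula\<close>

text \<open>A strictly increasing \<open>f\<close> has at most one point in each fibre, so the
  counting integral collapses to a value of \<open>k\<close> at the inverse and the claim becomes
  the substitution rule. Sums over fibres are written as counting integrals because these need no
  finiteness.\<close>

lemma nn_integral_area_interval_pos:
  fixes f f' :: "real \<Rightarrow> real" and k :: "real \<Rightarrow> ennreal"
  assumes k[measurable]: "k \<in> borel_measurable borel"
    and deriv: "\<And>x. x \<in> {a..b} \<Longrightarrow> (f has_real_derivative f' x) (at x)"
    and cont: "continuous_on {a..b} f'"
    and pos: "\<And>x. x \<in> {a..b} \<Longrightarrow> 0 < f' x"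
    and "a < b"
  shows "(\<lambda>y. \<integral>\<^sup>+t. k t * indicator {t \<in> {a..b}. f t = y} t \<partial>count_space UNIV) \<in> borel_measurable borel"
    and "(\<integral>\<^sup>+t. k t * ennreal (f' t) * indicator {a..b} t \<partial>lborel) =
         (\<integral>\<^sup>+y. (\<integral>\<^sup>+t. k t * indicator {t \<in> {a..b}. f t = y} t \<partial>count_space UNIV) \<partial>lborel)"
proof -
  define g where "g = the_inv_into {a..b} f"
  define \<phi> where "\<phi> = (\<lambda>y. \<integral>\<^sup>+t. k t * indicator {t \<in> {a..b}. f t = y} t \<partial>count_space UNIV)"
  have contf: "continuous_on {a..b} f"
    using deriv by (rule has_real_derivative_imp_continuous_on)
  have mono: "f x < f y" if "a \<le> x" "x < y" "y \<le> b" for x y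
  proof (rule DERIV_pos_imp_increasing[OF \<open>x < y\<close>])
    fix z assume "x \<le> z" "z \<le> y"
    then have "z \<in> {a..b}"
      using that by auto
    then show "\<exists>d. (f has_real_derivative d) (at z) \<and> 0 < d"
      using deriv pos by blast
  qed
  then have inj: "inj_on f {a..b}"
    by (auto simp: inj_on_def) (metis linorder_neqE_linordered_idom less_irrefl)
  have image: "f ` {a..b} = {f a..f b}"
  proof (intro equalityI subsetI)
    fix y assume "y \<in> f ` {a..b}"
    then obtain x where "a \<le> x" "x \<le> b" "y = f x" by auto
    then show "y \<in> {f a..f b}"
      using mono[of a x] mono[of x b] by (cases "a = x"; cases "x = b") auto
  next
    fix y assume "y \<in> {f a..f b}"
    then show "y \<in> f ` {a..b}"
      using IVT'[of f a y b] contf \<open>a < b\<close> by force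
  qed
  have gf: "g (f x) = x" if "x \<in> {a..b}" for x
    unfolding g_def by (rule the_inv_into_f_f[OF inj that])
  have "continuous_on (f ` {a..b}) g"
    by (rule continuous_on_inv[OF contf compact_Icc]) (simp add: gf)
  then have "continuous_on {f a..f b} g"
    unfolding image .
  \<comment> \<open>The inverse is continuous only on the image, so it is extended by
    \<open>0\<close>; the spurious value \<open>k 0\<close> off the image is cancelled by an
    indicator in the formula for \<open>\<phi>\<close> below.\<close>
  then have [measurable]: "(\<lambda>y. indicator {f a..f b} y *\<^sub>R g y) \<in> borel_measurable borel"
    by (intro borel_measurable_continuous_on_indicator) auto
  have \<phi>: "\<phi> y = k (indicator {f a..f b} y *\<^sub>R g y) * indicator {f a..f b} y" for y
  proof (cases "y \<in> f ` {a..b}")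
    case True
    then obtain x where x: "x \<in> {a..b}" "y = f x" by auto
    have *: "{t \<in> {a..b}. f t = y} = {x}"
      using x inj by (auto simp: inj_on_def)
    have "\<phi> y = (\<Sum>t\<in>{x}. k t * indicator {x} t)"
      unfolding \<phi>_def * by (rule nn_integral_count_space') auto
    with x True show ?thesis
      by (simp add: gf image)
  next
    case False
    then have *: "{t \<in> {a..b}. f t = y} = {}" by auto
    show ?thesis
      using False unfolding \<phi>_def * image by simp
  qed
  have meas: "\<phi> \<in> borel_measurable borel"
    unfolding \<phi> by measurable
  then show "(\<lambda>y. \<integral>\<^sup>+t. k t * indicator {t \<in> {a..b}. f t = y} t \<partial>count_space UNIV) \<in> borel_measurable borel"
    unfolding \<phi>_def .
  have "(\<integral>\<^sup>+y. \<phi> y \<partial>lborel) = (\<integral>\<^sup>+y. \<phi> y * indicator {f a..f b} y \<partial>lborel)"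
    by (intro nn_integral_cong) (simp add: \<phi> split: split_indicator)
  also have "\<dots> = (\<integral>\<^sup>+x. \<phi> (f x) * f' x * indicator {a..b} x \<partial>lborel)"
    using pos by (intro nn_integral_substitution_aux[OF meas _ deriv cont _ \<open>a < b\<close>]) (auto intro: less_imp_le)
  also have "\<dots> = (\<integral>\<^sup>+t. k t * ennreal (f' t) * indicator {a..b} t \<partial>lborel)"
  proof (intro nn_integral_cong)
    fix x
    have "f x \<in> {f a..f b}" if "x \<in> {a..b}"
      using that image by blast
    then show "\<phi> (f x) * f' x * indicator {a..b} x = k x * ennreal (f' x) * indicator {a..b} x"
      by (simp add: \<phi> gf split: split_indicator)
  qed
  finally show "(\<integral>\<^sup>+t. k t * ennreal (f' t) * indicator {a..b} t \<partial>lborel) =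
         (\<integral>\<^sup>+y. (\<integral>\<^sup>+t. k t * indicator {t \<in> {a..b}. f t = y} t \<partial>count_space UNIV) \<partial>lborel)"
    by (simp add: \<phi>_def)
qed

lemma nn_integral_area_interval:
  fixes f f' :: "real \<Rightarrow> real" and k :: "real \<Rightarrow> ennreal"
  assumes k[measurable]: "k \<in> borel_measurable borel"
    and deriv: "\<And>x. x \<in> {a..b} \<Longrightarrow> (f has_real_derivative f' x) (at x)"
    and cont: "continuous_on {a..b} f'"
    and nz: "\<And>x. x \<in> {a..b} \<Longrightarrow> f' x \<noteq> 0"
  shows "(\<lambda>y. \<integral>\<^sup>+t. k t * indicator {t \<in> {a..b}. f t = y} t \<partial>count_space UNIV) \<in> borel_measurable borel" (is ?meas)
    and "(\<integral>\<^sup>+t. k t * ennreal \<bar>f' t\<bar> * indicator {a..b} t \<partial>lborel) =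
         (\<integral>\<^sup>+y. (\<integral>\<^sup>+t. k t * indicator {t \<in> {a..b}. f t = y} t \<partial>count_space UNIV) \<partial>lborel)" (is ?int)
proof -
  consider "b < a" | "a = b" | "a < b" by linarith
  then have "?meas \<and> ?int"
  proof cases
    case 1
    then show ?thesis by simp
  next
    case 2
    \<comment> \<open>Over a single point both sides vanish: the left integrand lives on a null set,
      and the counting integral can be nonzero only at \<open>f a\<close>.\<close>
    have *: "(\<integral>\<^sup>+t. k t * indicator {t \<in> {a..b}. f t = y} t \<partial>count_space UNIV) = k a * indicator {f a} y" for y
    proof -
      have "(\<integral>\<^sup>+t. k t * indicator {t \<in> {a..b}. f t = y} t \<partial>count_space UNIV)
          = (\<integral>\<^sup>+t. k a * indicator {f a} y * indicator {a} t \<partial>count_space UNIV)"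
        using 2 by (intro nn_integral_cong) (auto split: split_indicator)
      then show ?thesis
        by (simp add: nn_integral_cmult)
    qed
    have "(\<integral>\<^sup>+t. k t * ennreal \<bar>f' t\<bar> * indicator {a..b} t \<partial>lborel) = (\<integral>\<^sup>+t. 0 \<partial>(lborel :: real measure))"
      by (intro nn_integral_cong_AE AE_I'[of "{a}"]) (auto simp: 2 split: split_indicator)
    then show ?thesis
      unfolding * by (simp add: nn_integral_cmult)
  next
    case 3
    have pos_or_neg: "(\<forall>x\<in>{a..b}. 0 < f' x) \<or> (\<forall>x\<in>{a..b}. f' x < 0)"
    proof (rule ccontr)
      assume "\<not> ?thesis"
      then obtain x y where xy: "x \<in> {a..b}" "y \<in> {a..b}" "f' x < 0" "0 < f' y"
        using nz by (meson linorder_neqE_linordered_idom)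
      have "connected (f' ` {a..b})"
        by (rule connected_continuous_image[OF cont]) simp
      then have "0 \<in> f' ` {a..b}"
        using xy by (meson connected_contains_Icc atLeastAtMost_iff imageI less_imp_le subsetD)
      then show False using nz by auto
    qed
    then show ?thesis
    proof
      assume pos: "\<forall>x\<in>{a..b}. 0 < f' x"
      have "(\<integral>\<^sup>+t. k t * ennreal \<bar>f' t\<bar> * indicator {a..b} t \<partial>lborel) =
          (\<integral>\<^sup>+t. k t * ennreal (f' t) * indicator {a..b} t \<partial>lborel)"
        using pos by (intro nn_integral_cong) (auto simp: abs_of_pos split: split_indicator)
      then show ?thesis
        using nn_integral_area_interval_pos[OF k deriv cont _ 3] pos by auto
    next
      assume neg: "\<forall>x\<in>{a..b}. f' x < 0"
      \<comment> \<open>\<open>\<phi>\<close> belongs to the fibres of \<open>- f\<close>, so the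
        fibre sum of \<open>f\<close> at \<open>y\<close> is \<open>\<phi> (- y)\<close>; reflecting
        the line preserves Lebesgue measure.\<close>
      define \<phi> where "\<phi> = (\<lambda>y. \<integral>\<^sup>+t. k t * indicator {t \<in> {a..b}. - f t = y} t \<partial>count_space UNIV)"
      have area: "\<phi> \<in> borel_measurable borel"
        "(\<integral>\<^sup>+t. k t * ennreal (- f' t) * indicator {a..b} t \<partial>lborel) = (\<integral>\<^sup>+y. \<phi> y \<partial>lborel)"
        using nn_integral_area_interval_pos[OF k, of a b "\<lambda>t. - f t" "\<lambda>t. - f' t"]
          DERIV_minus[OF deriv] continuous_on_minus[OF cont] neg 3
        unfolding \<phi>_def by auto
      have *: "(\<integral>\<^sup>+t. k t * indicator {t \<in> {a..b}. f t = y} t \<partial>count_space UNIV) = \<phi> (- y)" for y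
        unfolding \<phi>_def by simp
      have "(\<integral>\<^sup>+t. k t * ennreal \<bar>f' t\<bar> * indicator {a..b} t \<partial>lborel) =
          (\<integral>\<^sup>+t. k t * ennreal (- f' t) * indicator {a..b} t \<partial>lborel)"
        using neg by (intro nn_integral_cong) (auto simp: abs_of_neg split: split_indicator)
      then show ?thesis
        unfolding * using area nn_integral_real_affine[OF area(1), of "-1" 0] by simp
    qed
  qed
  then show ?meas ?int by auto
qed

text \<open>Cutting the open set into countably many disjoint Borel pieces, each contained in a compact
  interval on which the derivative has constant sign.\<close>

lemma nn_integral_area:
  fixes f f' :: "real \<Rightarrow> real" and k :: "real \<Rightarrow> ennreal"
  assumes k[measurable]: "k \<in> borel_measurable borel"
    and "open S"
    and deriv: "\<And>x. x \<in> S \<Longrightarrow> (f has_real_derivative f' x) (at x)"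
    and cont: "continuous_on S f'"
    and nz: "\<And>x. x \<in> S \<Longrightarrow> f' x \<noteq> 0"
  shows "(\<lambda>y. \<integral>\<^sup>+t. k t * indicator {t \<in> S. f t = y} t \<partial>count_space UNIV) \<in> borel_measurable borel"
    and "(\<integral>\<^sup>+t. k t * ennreal \<bar>f' t\<bar> * indicator S t \<partial>lborel) =
         (\<integral>\<^sup>+y. (\<integral>\<^sup>+t. k t * indicator {t \<in> S. f t = y} t \<partial>count_space UNIV) \<partial>lborel)"
proof -
  obtain \<D> where \<D>: "countable \<D>" "\<And>X. X \<in> \<D> \<Longrightarrow> X \<subseteq> S" "\<And>X. X \<in> \<D> \<Longrightarrow> \<exists>a b. X = cbox a b" "\<Union>\<D> = S"
    using open_countable_Union_open_cbox[OF \<open>open S\<close>] by (metis Pow_iff subsetD)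
  \<comment> \<open>Adding the empty set keeps the family nonempty, so that
    \<open>from_nat_into\<close> enumerates it even when \<open>S\<close> is empty.\<close>
  define I where "I = from_nat_into (insert {} \<D>)"
  define E where "E = disjointed I"
  have "range I = insert {} \<D>"
    unfolding I_def using \<D>(1) by (intro range_from_nat_into) auto
  then have I: "\<exists>a b. I n = {a..b}" "I n \<subseteq> S" "(\<Union>n. I n) = S" for n
  proof -
    have "I n \<in> insert {} \<D>"
      using \<open>range I = insert {} \<D>\<close> by auto
    moreover have "{} = {1..0::real}"
      by simp
    ultimately show "\<exists>a b. I n = {a..b}" "I n \<subseteq> S"
      using \<D>(2,3) unfolding cbox_interval by blast+
  qed (use \<open>range I = insert {} \<D>\<close> \<D>(4) in simp)
  have E: "disjoint_family E" "(\<Union>n. E n) = S" "E n \<subseteq> I n" for n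
    unfolding E_def I(3)[symmetric]
    by (rule disjoint_family_disjointed UN_disjointed_eq disjointed_subset)+
  have "range I \<subseteq> sets borel"
    using I(1) by (metis image_subsetI atLeastAtMost_borel)
  then have [measurable]: "E n \<in> sets borel" for n
    unfolding E_def using sets.range_disjointed_sets by blast
  \<comment> \<open>The interval version integrates over all of \<open>I n\<close>; the restriction
    to the disjoint piece \<open>E n\<close> is absorbed into the weight, which may be any Borel
    function.\<close>
  define \<phi> where "\<phi> = (\<lambda>n y. \<integral>\<^sup>+t. (k t * indicator (E n) t) * indicator {t \<in> I n. f t = y} t \<partial>count_space UNIV)"
  have piece: "\<phi> n \<in> borel_measurable borel"
    "(\<integral>\<^sup>+t. (k t * indicator (E n) t) * ennreal \<bar>f' t\<bar> * indicator (I n) t \<partial>lborel) = (\<integral>\<^sup>+y. \<phi> n y \<partial>lborel)" for n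
  proof -
    obtain a b where ab: "I n = {a..b}" using I(1) by blast
    have *: "(\<lambda>t. k t * indicator (E n) t) \<in> borel_measurable borel"
      by measurable
    show "\<phi> n \<in> borel_measurable borel"
      "(\<integral>\<^sup>+t. (k t * indicator (E n) t) * ennreal \<bar>f' t\<bar> * indicator (I n) t \<partial>lborel) = (\<integral>\<^sup>+y. \<phi> n y \<partial>lborel)"
      unfolding \<phi>_def ab
      using nn_integral_area_interval[OF *, of a b f f'] deriv continuous_on_subset[OF cont] nz I(2)[of n]
      unfolding ab by blast+
  qed
  have sum_E: "(\<Sum>n. c * indicator (E n) t) = c * indicator S t" for c :: ennreal and t
    using suminf_indicator[OF E(1), of t] by (simp add: E(2))
  have sum: "(\<integral>\<^sup>+t. k t * indicator {t \<in> S. f t = y} t \<partial>count_space UNIV) = (\<Sum>n. \<phi> n y)" for y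
  proof -
    have "(\<Sum>n. \<phi> n y) = (\<integral>\<^sup>+t. (\<Sum>n. (k t * indicator (E n) t) * indicator {t \<in> I n. f t = y} t) \<partial>count_space UNIV)"
      unfolding \<phi>_def by (intro nn_integral_suminf[symmetric]) simp
    also have "\<dots> = (\<integral>\<^sup>+t. (\<Sum>n. (k t * indicator {t. f t = y} t) * indicator (E n) t) \<partial>count_space UNIV)"
      using E(3) by (intro nn_integral_cong suminf_cong) (auto split: split_indicator)
    also have "\<dots> = (\<integral>\<^sup>+t. k t * indicator {t \<in> S. f t = y} t \<partial>count_space UNIV)"
      unfolding sum_E by (intro nn_integral_cong) (auto split: split_indicator)
    finally show ?thesis ..
  qed
  show "(\<lambda>y. \<integral>\<^sup>+t. k t * indicator {t \<in> S. f t = y} t \<partial>count_space UNIV) \<in> borel_measurable borel"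
    unfolding sum using piece(1) by measurable
  \<comment> \<open>Nothing is assumed about \<open>f'\<close> outside \<open>S\<close>, so
    measurability is available only for its product with the indicator of \<open>S\<close>; that
    product is kept as one factor below.\<close>
  have f'_meas: "(\<lambda>t. ennreal \<bar>f' t\<bar> * indicator S t) \<in> borel_measurable borel"
  proof -
    have "(\<lambda>t. indicator S t *\<^sub>R f' t) \<in> borel_measurable borel"
      using \<open>open S\<close> cont by (intro borel_measurable_continuous_on_indicator) auto
    then have "(\<lambda>t. ennreal \<bar>indicator S t *\<^sub>R f' t\<bar>) \<in> borel_measurable borel"
      by measurable
    also have "(\<lambda>t. ennreal \<bar>indicator S t *\<^sub>R f' t\<bar>) = (\<lambda>t. ennreal \<bar>f' t\<bar> * indicator S t)"
      by (auto simp: fun_eq_iff split: split_indicator)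
    finally show ?thesis .
  qed
  have "(\<integral>\<^sup>+t. k t * ennreal \<bar>f' t\<bar> * indicator S t \<partial>lborel)
      = (\<integral>\<^sup>+t. (\<Sum>n. k t * (ennreal \<bar>f' t\<bar> * indicator S t) * indicator (E n) t) \<partial>lborel)"
    unfolding sum_E by (intro nn_integral_cong) (auto split: split_indicator)
  also have "\<dots> = (\<Sum>n. \<integral>\<^sup>+t. k t * (ennreal \<bar>f' t\<bar> * indicator S t) * indicator (E n) t \<partial>lborel)"
  proof (rule nn_integral_suminf)
    show "(\<lambda>t. k t * (ennreal \<bar>f' t\<bar> * indicator S t) * indicator (E n) t) \<in> borel_measurable lborel" for n
      by (intro borel_measurable_times_ennreal[of _ _ "indicator (E n)"]
            borel_measurable_times_ennreal[of k _ "\<lambda>t. ennreal \<bar>f' t\<bar> * indicator S t"]) (simp_all add: f'_meas)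
  qed
  also have "\<dots> = (\<Sum>n. \<integral>\<^sup>+y. \<phi> n y \<partial>lborel)"
    unfolding piece(2)[symmetric] using E(3) I(2)
    by (intro suminf_cong nn_integral_cong) (auto split: split_indicator)
  also have "\<dots> = (\<integral>\<^sup>+y. (\<Sum>n. \<phi> n y) \<partial>lborel)"
    using piece(1) by (intro nn_integral_suminf[symmetric]) simp
  finally show "(\<integral>\<^sup>+t. k t * ennreal \<bar>f' t\<bar> * indicator S t \<partial>lborel) =
         (\<integral>\<^sup>+y. (\<integral>\<^sup>+t. k t * indicator {t \<in> S. f t = y} t \<partial>count_space UNIV) \<partial>lborel)"
    unfolding sum .
qed

section \<open>The invariant measure of a lift conjugated with an irrational translation\<close>

lemma circle_cover_eq_iff: "circle_cover s = circle_cover t \<longleftrightarrow> (\<exists>k. t = s + of_int k)"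
proof
  assume "circle_cover s = circle_cover t"
  then have "frac s = frac t"
    using Arg2pi_circle_cover[of s] Arg2pi_circle_cover[of t] by simp
  then have "t = s + of_int (\<lfloor>t\<rfloor> - \<lfloor>s\<rfloor>)"
    by (simp add: frac_def)
  then show "\<exists>k. t = s + of_int k" ..
qed (auto simp: circle_cover_add_int)

lemma circle_cover_Arg2pi: "z \<in> sphere 0 1 \<Longrightarrow> circle_cover (Arg2pi z / (2 * pi)) = z"
  using complex_norm_eq_1_exp[of z] by (simp add: circle_cover_def cis_conv_exp)

lemma circle_cover_in_arc_iff:
  "circle_cover x \<in> circle_cover ` {s..<t} \<longleftrightarrow> (\<exists>k. x + of_int k \<in> {s..<t})"
  unfolding image_iff circle_cover_eq_iff by blast

lemma circle_cover_arc_subset: "circle_cover ` S \<subseteq> sphere 0 1"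
  by (auto simp: circle_cover_def)

lemma circle_cover_arc_period: "circle_cover ` {s..<s + 1} = sphere 0 1"
proof (intro equalityI subsetI circle_cover_arc_subset[THEN subsetD])
  fix z :: complex assume "z \<in> sphere 0 1"
  then obtain x where x: "z = circle_cover x"
    using circle_cover_Arg2pi[of z] by metis
  have "x + of_int (- \<lfloor>x - s\<rfloor>) \<in> {s..<s + 1}"
    by simp linarith
  then show "z \<in> circle_cover ` {s..<s + 1}"
    unfolding x circle_cover_in_arc_iff by blast
qed

lemma circle_cover_arc_add_int:
  "circle_cover ` {s + of_int k..<t + of_int k} = circle_cover ` {s..<t}"
proof -
  have "{s + of_int k..<t + of_int k} = (\<lambda>x. x + of_int k) ` {s..<t}"
    by (simp add: image_add_atLeastLessThan')
  then show ?thesis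
    by (simp only: image_image circle_cover_add_int)
qed

lemma circle_cover_arc_Un:
  "s \<le> t \<Longrightarrow> t \<le> u \<Longrightarrow> circle_cover ` {s..<t} \<union> circle_cover ` {t..<u} = circle_cover ` {s..<u}"
  by (simp add: image_Un[symmetric] ivl_disj_un_two)

text \<open>A common point would give two parameters, one in each interval, that differ by an
  integer strictly between \<open>0\<close> and \<open>1\<close>.\<close>

lemma circle_cover_arc_disjoint:
  assumes "u \<le> s + 1"
  shows "circle_cover ` {s..<t} \<inter> circle_cover ` {t..<u} = {}"
proof -
  have False if "x \<in> {s..<t}" "x + of_int k \<in> {t..<u}" for x k
  proof -
    have "0 < real_of_int k" "real_of_int k < 1"
      using that assms by auto
    then show False by simp
  qed
  then have "circle_cover x \<notin> circle_cover ` {t..<u}" if "x \<in> {s..<t}" for x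
    unfolding circle_cover_in_arc_iff using that by blast
  then show ?thesis by blast
qed

lemma space_circle_borel:
  assumes "sets \<mu> = sets circle_borel"
  shows "space \<mu> = sphere 0 1"
  using sets_eq_imp_space_eq[OF assms] by (simp add: circle_borel_def space_restrict_space)

lemma measurable_Arg2pi_circle_borel:
  assumes "sets \<mu> = sets circle_borel"
  shows "(\<lambda>z. Arg2pi z / (2 * pi)) \<in> borel_measurable \<mu>"
proof -
  have [measurable]: "Arg2pi \<in> borel_measurable borel"
    unfolding borel_measurable_iff_greater by (simp add: open_Arg2pi2pi_gt)
  have "(\<lambda>z. Arg2pi z / (2 * pi)) \<in> borel_measurable borel"
    by measurable
  then show ?thesis
    unfolding measurable_cong_sets[OF assms refl] circle_borel_def
    by (rule measurable_restrict_space1)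
qed

text \<open>Continuous images of Borel sets need not be Borel, but those of compact sets are; hence
  the exhaustion of the half-open interval by compact ones.\<close>

lemma circle_cover_arc_borel: "circle_cover ` {s..<t} \<in> sets circle_borel"
proof -
  have "{s..<t} = (\<Union>n. {s..t - 1 / real (Suc n)})"
  proof (intro equalityI subsetI)
    fix x assume x: "x \<in> {s..<t}"
    then obtain n where "1 / real (Suc n) < t - x"
      using nat_approx_posE[of "t - x"] by auto
    with x show "x \<in> (\<Union>n. {s..t - 1 / real (Suc n)})"
      by (auto intro!: exI[of _ n])
  next
    fix x assume "x \<in> (\<Union>n. {s..t - 1 / real (Suc n)})"
    then obtain n where "s \<le> x" "x \<le> t - 1 / real (Suc n)" by auto
    moreover have "0 < 1 / real (Suc n)" by simp
    ultimately have "x < t" by linarith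
    with \<open>s \<le> x\<close> show "x \<in> {s..<t}" by simp
  qed
  moreover have "circle_cover ` {a..b} \<in> sets borel" for a b
  proof -
    have "continuous_on {a..b} circle_cover"
      unfolding circle_cover_def by (intro continuous_intros)
    then show ?thesis
      by (intro borel_compact compact_continuous_image) auto
  qed
  ultimately have "circle_cover ` {s..<t} \<in> sets borel"
    by (auto simp: image_UN)
  moreover have "sphere 0 1 \<in> sets (borel :: complex measure)"
    by (intro borel_closed) auto
  ultimately show ?thesis
    unfolding circle_borel_def using circle_cover_arc_subset
    by (subst sets_restrict_space_iff) auto
qed

text \<open>\<open>K x - x\<close> is invariant under the dense group of translations by \<open>k \<rho> - h\<close>; monotonicity of \<open>K\<close>
  replaces the continuity that would otherwise be needed to conclude that it is constant.\<close>

lemma mono_lift_commuting_irrational_translation: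
  fixes K :: "real \<Rightarrow> real"
  assumes mono: "mono K"
    and lift: "\<And>x. K (x + 1) = K x + 1"
    and trans: "\<And>x. K (x + \<rho>) = K x + c"
    and irrational: "\<rho> \<notin> \<rat>"
  shows "K y - K x = y - x"
proof -
  have add_int: "K (x + of_int n) = K x + of_int n" for x n
    by (rule lift_add_int) (rule lift)
  have add_nat: "K (x + real m * \<rho>) = K x + real m * c" for x m
  proof (induction m)
    case (Suc m)
    have "K (x + real (Suc m) * \<rho>) = K ((x + real m * \<rho>) + \<rho>)"
      by (simp add: algebra_simps)
    then show ?case
      unfolding trans Suc by (simp add: algebra_simps)
  qed simp
  \<comment> \<open>\<open>K y - y\<close> is periodic, so only \<open>frac y\<close> matters, and
    there monotonicity traps \<open>K\<close> between \<open>K 0\<close> and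
    \<open>K 0 + 1\<close>.\<close>
  have bounded: "\<bar>K y - y - K 0\<bar> \<le> 1" for y
  proof -
    have "K y = K (frac y) + of_int \<lfloor>y\<rfloor>"
      using add_int[of "frac y" "\<lfloor>y\<rfloor>"] by (simp add: frac_def)
    moreover have "K 0 \<le> K (frac y)" "K (frac y) \<le> K 0 + 1"
      using monoD[OF mono, of 0 "frac y"] monoD[OF mono, of "frac y" "0 + 1"] lift[of 0] frac_lt_1[of y] frac_ge_0[of y]
      by auto
    ultimately show ?thesis
      using frac_lt_1[of y] frac_ge_0[of y] by (simp add: frac_def) linarith
  qed
  \<comment> \<open>Each translation by \<open>\<rho>\<close> changes \<open>K y - y\<close> by
    \<open>c - \<rho>\<close>; a nonzero drift would accumulate beyond the bound.\<close>
  have "c = \<rho>"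
  proof (rule ccontr)
    assume "c \<noteq> \<rho>"
    then obtain m :: nat where "1 < real m * \<bar>c - \<rho>\<bar>"
      using reals_Archimedean3[of "\<bar>c - \<rho>\<bar>"] by auto
    moreover have "K (real m * \<rho>) - real m * \<rho> - K 0 = real m * (c - \<rho>)"
      using add_nat[of 0 m] by (simp add: algebra_simps)
    ultimately show False
      using bounded[of "real m * \<rho>"] by (simp add: abs_mult)
  qed
  have upper: "K y - K x \<le> y - x" for x y
  proof (rule field_le_epsilon)
    fix e :: real assume "0 < e"
    \<comment> \<open>Target \<open>y - x + e / 2\<close> with tolerance \<open>e / 2\<close> puts
      the translation \<open>d\<close> between \<open>y - x\<close> and \<open>y - x + e\<close>:
      far enough to reach \<open>y\<close>, at an extra cost of at most \<open>e\<close>. Positivity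
      of \<open>k\<close> allows forward iteration of \<open>trans\<close>.\<close>
    then obtain h k where hk: "k > 0" "\<bar>of_int k * \<rho> - of_int h - (y - x + e / 2)\<bar> < e / 2"
      using sequence_of_fractional_parts_is_dense[OF irrational half_gt_zero] by blast
    define d where "d = of_int k * \<rho> - of_int h"
    have d: "y - x \<le> d" "d \<le> y - x + e"
      using hk(2) unfolding d_def by arith+
    have "K (x + d) = K (x + real (nat k) * \<rho> + of_int (- h))"
      using hk(1) by (simp add: d_def algebra_simps)
    also have "\<dots> = K x + d"
      unfolding add_int add_nat using hk(1) by (simp add: d_def \<open>c = \<rho>\<close>)
    finally have "K (x + d) = K x + d" .
    moreover have "K y \<le> K (x + d)"
      using d by (intro monoD[OF mono]) simp
    ultimately show "K y - K x \<le> y - x + e"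
      using d by simp
  qed
  show ?thesis
    using upper[of y x] upper[of x y] by simp
qed

text \<open>Differentiating \<open>inv f (f x) = x\<close> rules out a zero derivative, and
  monotonicity fixes the sign.\<close>

lemma lift_circle_diffeo_derivative:
  assumes "lift_circle_diffeo f"
  shows "(f has_real_derivative deriv f x) (at x)"
    and "continuous_on UNIV (deriv f)"
    and "0 < deriv f x"
proof -
  have D: "\<exists>D. (\<forall>x. (h has_real_derivative D x) (at x)) \<and> continuous_on UNIV D"
    if "h C1_differentiable_on UNIV" for h :: "real \<Rightarrow> real"
    using that unfolding C1_differentiable_on_def has_real_derivative_iff_has_vector_derivative by auto
  from D[of f] obtain D1 where D1: "\<And>x. (f has_real_derivative D1 x) (at x)" "continuous_on UNIV D1"
    using assms unfolding lift_circle_diffeo_def by blast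
  from D[of "inv f"] obtain D2 where D2: "\<And>x. (inv f has_real_derivative D2 x) (at x)"
    using assms unfolding lift_circle_diffeo_def by blast
  have eq: "deriv f = D1"
    using D1(1) by (auto intro: DERIV_imp_deriv)
  show d: "(f has_real_derivative deriv f x) (at x)" and "continuous_on UNIV (deriv f)"
    using D1 by (simp_all add: eq)
  have "((\<lambda>x. inv f (f x)) has_real_derivative D2 (f x) * deriv f x) (at x)"
    by (rule DERIV_chain2[OF D2 d])
  moreover have "inj f" "strict_mono f"
    using assms by (auto simp: lift_circle_diffeo_def bij_def)
  ultimately have "((\<lambda>x. x) has_real_derivative D2 (f x) * deriv f x) (at x)"
    by simp
  then have "deriv f x \<noteq> 0"
    using DERIV_unique[OF _ DERIV_ident] by fastforce
  moreover have "mono_on UNIV f"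
    using \<open>strict_mono f\<close> by (simp add: strict_mono_mono)
  then have "0 \<le> deriv f x"
    by (rule mono_on_imp_deriv_nonneg) (use d in auto)
  ultimately show "0 < deriv f x" by simp
qed

text \<open>\<open>G\<close> is the distribution function of \<open>\<mu>\<close> unrolled to the
  line, each full turn contributing \<open>1\<close>. Its increments are arc masses only up to one
  turn, since a longer arc would overlap itself.\<close>

lemma arc_cdf_lift:
  assumes sets: "sets \<mu> = sets circle_borel" and prob: "emeasure \<mu> (space \<mu>) = 1"
  defines "G \<equiv> \<lambda>t. of_int \<lfloor>t\<rfloor> + measure \<mu> (circle_cover ` {of_int \<lfloor>t\<rfloor>..<t})"
  shows "G (t + 1) = G t + 1"
    and "s \<le> t \<Longrightarrow> t \<le> s + 1 \<Longrightarrow> measure \<mu> (circle_cover ` {s..<t}) = G t - G s"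
proof -
  define a where "a = (\<lambda>s t. measure \<mu> (circle_cover ` {s..<t}))"
  interpret finite_measure \<mu>
    by standard (simp add: prob)
  have space: "space \<mu> = sphere 0 1"
    by (rule space_circle_borel[OF sets])
  have shift: "a (s + of_int k) (t + of_int k) = a s t" for s t k
    unfolding a_def circle_cover_arc_add_int ..
  have full: "a s (s + 1) = 1" for s
    using prob unfolding a_def circle_cover_arc_period space[symmetric] measure_def by simp
  have add: "a s t + a t u = a s u" if "s \<le> t" "t \<le> u" "u \<le> s + 1" for s t u
    unfolding a_def circle_cover_arc_Un[OF that(1,2), symmetric]
    by (intro finite_measure_Union[symmetric] circle_cover_arc_disjoint that)
       (simp_all add: sets circle_cover_arc_borel)
  have G: "G t = of_int \<lfloor>t\<rfloor> + a (of_int \<lfloor>t\<rfloor>) t" for t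
    by (simp add: G_def a_def)
  show "G (t + 1) = G t + 1"
    using shift[of "of_int \<lfloor>t\<rfloor>" 1 t] by (simp add: G)
  assume st: "s \<le> t" "t \<le> s + 1"
  \<comment> \<open>An interval of length at most one passes at most one new integer. If it does,
    the arc is split there, and \<open>full\<close> supplies the total mass of the unit cell
    containing \<open>s\<close>.\<close>
  then have "\<lfloor>t\<rfloor> = \<lfloor>s\<rfloor> \<or> \<lfloor>t\<rfloor> = \<lfloor>s\<rfloor> + 1"
    using floor_mono[of s t] floor_mono[of t "s + 1"] by auto
  then have "a s t = G t - G s"
  proof
    assume *: "\<lfloor>t\<rfloor> = \<lfloor>s\<rfloor>"
    have "t \<le> of_int \<lfloor>s\<rfloor> + 1"
      using * by linarith
    then show ?thesis
      using add[of "of_int \<lfloor>s\<rfloor>" s t] st by (simp add: G *)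
  next
    assume *: "\<lfloor>t\<rfloor> = \<lfloor>s\<rfloor> + 1"
    have "s \<le> of_int \<lfloor>s\<rfloor> + 1" "of_int \<lfloor>s\<rfloor> + 1 \<le> t"
      using * by linarith+
    then show ?thesis
      using add[of "of_int \<lfloor>s\<rfloor>" s "of_int \<lfloor>s\<rfloor> + 1"] add[of s "of_int \<lfloor>s\<rfloor> + 1" t] full[of "of_int \<lfloor>s\<rfloor>"] st
      by (simp add: G *)
  qed
  then show "measure \<mu> (circle_cover ` {s..<t}) = G t - G s"
    by (simp add: a_def)
qed

text \<open>A strictly increasing \<open>f\<close> commuting with integer translations makes the arc
  over \<open>{s..<t}\<close> the exact preimage of the arc over \<open>{f s..<f t}\<close>, so
  invariance equates their masses.\<close>

lemma invariant_prob_arc_image: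
  assumes f: "lift_circle_diffeo f" and inv: "invariant_prob (circle_map f) \<mu>"
  shows "measure \<mu> (circle_cover ` {f s..<f t}) = measure \<mu> (circle_cover ` {s..<t})"
proof -
  have lift: "\<And>t. f (t + 1) = f t + 1" and mono: "strict_mono f"
    using f by (auto simp: lift_circle_diffeo_def)
  have sets: "sets \<mu> = sets circle_borel" and meas: "circle_map f \<in> measurable \<mu> \<mu>"
    and distr: "distr \<mu> \<mu> (circle_map f) = \<mu>"
    using inv by (auto simp: invariant_prob_def)
  have space: "space \<mu> = sphere 0 1"
    by (rule space_circle_borel[OF sets])
  have "circle_map f -` (circle_cover ` {f s..<f t}) \<inter> space \<mu> = circle_cover ` {s..<t}"
  proof -
    have "circle_map f (circle_cover x) \<in> circle_cover ` {f s..<f t} \<longleftrightarrow> circle_cover x \<in> circle_cover ` {s..<t}" for x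
      unfolding circle_map_circle_cover[of f, OF lift] circle_cover_in_arc_iff lift_add_int[of f, OF lift, symmetric]
      by (simp add: strict_mono_less_eq[OF mono] strict_mono_less[OF mono])
    then have "circle_map f z \<in> circle_cover ` {f s..<f t} \<longleftrightarrow> z \<in> circle_cover ` {s..<t}"
      if "z \<in> sphere 0 1" for z
      using circle_cover_Arg2pi[OF that] by metis
    then show ?thesis
      unfolding space using circle_cover_arc_subset by blast
  qed
  moreover have "measure (distr \<mu> \<mu> (circle_map f)) (circle_cover ` {f s..<f t})
      = measure \<mu> (circle_map f -` (circle_cover ` {f s..<f t}) \<inter> space \<mu>)"
    by (rule measure_distr[OF meas]) (simp add: sets circle_cover_arc_borel)
  ultimately show ?thesis
    by (simp add: distr)
qed

text \<open>\<open>\<Gamma>\<close> itself is, up to a constant, the unrolled distribution function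
  of \<open>\<mu>\<close>: in the coordinate \<open>\<Gamma>\<close> the map \<open>f\<close> is a
  translation, and the rigidity of monotone lifts commuting with it applies.\<close>

lemma invariant_prob_arc:
  assumes f: "lift_circle_diffeo f" and conj: "conjugated_with_translation_via f \<rho> \<Gamma>"
    and irrational: "\<rho> \<notin> \<rat>" and inv: "invariant_prob (circle_map f) \<mu>"
    and st: "s \<le> t" "t \<le> s + 1"
  shows "measure \<mu> (circle_cover ` {s..<t}) = \<Gamma> t - \<Gamma> s"
proof -
  define G where "G = (\<lambda>t. of_int \<lfloor>t\<rfloor> + measure \<mu> (circle_cover ` {of_int \<lfloor>t\<rfloor>..<t}))"
  have sets: "sets \<mu> = sets circle_borel" and prob: "emeasure \<mu> (space \<mu>) = 1"
    using inv by (auto simp: invariant_prob_def)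
  have lift_f: "\<And>t. f (t + 1) = f t + 1" and mono_f: "strict_mono f"
    using f by (auto simp: lift_circle_diffeo_def)
  have lift_\<Gamma>: "\<And>t. \<Gamma> (t + 1) = \<Gamma> t + 1" and mono_\<Gamma>: "strict_mono \<Gamma>" and bij_\<Gamma>: "bij \<Gamma>"
    and \<Gamma>_f: "\<And>t. \<Gamma> (f t) = \<Gamma> t + \<rho>"
    using conj by (auto simp: conjugated_with_translation_via_def lift_circle_diffeo_def)
  have G: "G (t + 1) = G t + 1"
    "s \<le> t \<Longrightarrow> t \<le> s + 1 \<Longrightarrow> measure \<mu> (circle_cover ` {s..<t}) = G t - G s" for s t
    unfolding G_def by (rule arc_cdf_lift[OF sets prob]; assumption)+
  have G_int: "G (t + of_int k) = G t + of_int k" for t k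
    by (rule lift_add_int) (rule G(1))
  have frac: "x = frac x + of_int \<lfloor>x\<rfloor>" for x :: real
    by (simp add: frac_def)
  have "mono G"
  proof (rule monoI)
    fix x y :: real assume "x \<le> y"
    \<comment> \<open>Removing whole turns leaves an increment over at most one turn, which is the
      mass of an arc and hence nonnegative.\<close>
    define n where "n = \<lfloor>y - x\<rfloor>"
    have "of_int n \<le> y - x" "y - x \<le> of_int n + 1"
      unfolding n_def by linarith+
    then have n: "0 \<le> n" "x \<le> y - of_int n" "y - of_int n \<le> x + 1"
      using \<open>x \<le> y\<close> by (simp add: n_def, linarith+)
    have "0 \<le> G (y - of_int n) - G x"
      unfolding G(2)[OF n(2,3), symmetric] by simp
    then show "G x \<le> G y"
      using G_int[of "y - of_int n" n] n(1) by simp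
  qed
  have G_f: "G (f x) = G x + (G (f 0) - G 0)" for x
  proof -
    \<comment> \<open>Passing to \<open>frac x\<close> keeps the arc from \<open>0\<close> and its
      image within one turn, where increments of \<open>G\<close> are masses and invariance can
      compare them.\<close>
    have y: "0 \<le> frac x" "frac x \<le> 0 + 1"
      using frac_lt_1[of x] by auto
    then have "f 0 \<le> f (frac x)" "f (frac x) \<le> f 0 + 1"
      unfolding lift_f[of 0, symmetric] by (simp_all only: strict_mono_less_eq[OF mono_f])
    from G(2)[OF this] have "G (f (frac x)) - G (f 0) = G (frac x) - G 0"
      unfolding invariant_prob_arc_image[OF f inv] G(2)[OF y] ..
    moreover have "G (f x) = G (f (frac x)) + of_int \<lfloor>x\<rfloor>"
      unfolding G_int[symmetric] lift_add_int[of f, OF lift_f, symmetric] frac[symmetric] ..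
    moreover have "G x = G (frac x) + of_int \<lfloor>x\<rfloor>"
      unfolding G_int[symmetric] frac[symmetric] ..
    ultimately show ?thesis by simp
  qed
  \<comment> \<open>\<open>K\<close> is \<open>G\<close> read in the coordinate that turns
    \<open>f\<close> into the translation by \<open>\<rho>\<close>.\<close>
  define K where "K = (\<lambda>x. G (inv \<Gamma> x))"
  have inv_eq: "inv \<Gamma> x = y" if "\<Gamma> y = x" for x y
    using that bij_\<Gamma> by (auto simp: bij_def)
  have \<Gamma>_inv: "\<Gamma> (inv \<Gamma> x) = x" for x
    using bij_\<Gamma> by (simp add: bij_def surj_f_inv_f)
  have "K (\<Gamma> t) - K (\<Gamma> s) = \<Gamma> t - \<Gamma> s"
  proof (rule mono_lift_commuting_irrational_translation[OF _ _ _ irrational])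
    have "inv \<Gamma> x \<le> inv \<Gamma> y" if "x \<le> y" for x y
      using that strict_mono_less_eq[OF mono_\<Gamma>, of "inv \<Gamma> x" "inv \<Gamma> y"] by (simp add: \<Gamma>_inv)
    then show "mono K"
      using \<open>mono G\<close> unfolding K_def mono_def by blast
    have "inv \<Gamma> (x + 1) = inv \<Gamma> x + 1" for x
      by (rule inv_eq) (simp add: lift_\<Gamma> \<Gamma>_inv)
    then show "K (x + 1) = K x + 1" for x
      by (simp add: K_def G(1))
    have "inv \<Gamma> (x + \<rho>) = f (inv \<Gamma> x)" for x
      by (rule inv_eq) (simp add: \<Gamma>_f \<Gamma>_inv)
    then show "K (x + \<rho>) = K x + (G (f 0) - G 0)" for x
      using G_f[of "inv \<Gamma> x"] by (simp add: K_def)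
  qed
  then show ?thesis
    unfolding G(2)[OF st] K_def by (simp add: inv_eq)
qed

text \<open>Closed upper half-lines form an intersection-stable generator of the Borel sets. They
  suit the angle coordinate, under which they pull back to half-open arcs ending at parameter
  \<open>1\<close>.\<close>

lemma measure_eqI_atLeast:
  fixes M N :: "real measure"
  assumes sets: "sets M = sets borel" "sets N = sets borel"
    and fin: "\<And>x. emeasure M {x..} < \<infinity>"
    and eq: "\<And>x. emeasure M {x..} = emeasure N {x..}"
  shows "M = N"
proof (rule measure_eqI_generator_eq[where E = "range atLeast" and A = "\<lambda>n. {- real n..}"])
  show "Int_stable (range (atLeast :: real \<Rightarrow> real set))"
    unfolding Int_stable_def by (auto intro: range_eqI[of _ _ "max _ _"])
  have "x \<in> (\<Union>n. {- real n..})" for x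
    using real_arch_simple[of "- x"] by (auto simp: minus_le_iff)
  then show "(\<Union>n. {- real n..}) = UNIV" by auto
  show "sets M = sigma_sets UNIV (range atLeast)" "sets N = sigma_sets UNIV (range atLeast)"
    unfolding sets borel_Ici by simp_all
qed (use fin eq in \<open>auto simp: less_top\<close>)

text \<open>The normalised angle inverts \<open>circle_cover\<close> on \<open>{0..<1}\<close>. Both
  measures of an upper half-line are then increments of \<open>\<Gamma>\<close>, one by the arc
  formula and the other by the fundamental theorem of calculus.\<close>

lemma distr_Arg2pi_invariant_prob:
  assumes f: "lift_circle_diffeo f" and conj: "conjugated_with_translation_via f \<rho> \<Gamma>"
    and irrational: "\<rho> \<notin> \<rat>" and inv: "invariant_prob (circle_map f) \<mu>"
  shows "distr \<mu> borel (\<lambda>z. Arg2pi z / (2 * pi)) =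
         density lborel (\<lambda>t. ennreal (deriv \<Gamma> t) * indicator {0..<1} t)" (is "?M = ?N")
proof (rule measure_eqI_atLeast)
  have \<Gamma>: "lift_circle_diffeo \<Gamma>"
    using conj by (simp add: conjugated_with_translation_via_def)
  note \<Gamma>' = lift_circle_diffeo_derivative[OF \<Gamma>]
  have [measurable]: "deriv \<Gamma> \<in> borel_measurable borel"
    by (rule borel_measurable_continuous_onI[OF \<Gamma>'(2)])
  have sets: "sets \<mu> = sets circle_borel" and prob: "emeasure \<mu> (space \<mu>) = 1"
    using inv by (auto simp: invariant_prob_def)
  interpret finite_measure \<mu>
    by standard (simp add: prob)
  have space: "space \<mu> = sphere 0 1"
    by (rule space_circle_borel[OF sets])
  have Arg_meas: "(\<lambda>z. Arg2pi z / (2 * pi)) \<in> borel_measurable \<mu>"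
    by (rule measurable_Arg2pi_circle_borel[OF sets])
  have M: "emeasure ?M {x..} = ennreal (\<Gamma> 1 - \<Gamma> (max 0 (min x 1)))" for x
  proof -
    \<comment> \<open>Clamping \<open>x\<close> to the unit interval treats all half-lines at once:
      the whole circle for \<open>x \<le> 0\<close>, the empty arc for
      \<open>x \<ge> 1\<close>.\<close>
    define y where "y = max 0 (min x 1)"
    have y: "y \<le> 1" "1 \<le> y + 1"
      by (auto simp: y_def)
    have "(\<lambda>z. Arg2pi z / (2 * pi)) -` {x..} \<inter> space \<mu> = circle_cover ` {y..<1}"
    proof (intro equalityI subsetI)
      fix z assume z: "z \<in> (\<lambda>z. Arg2pi z / (2 * pi)) -` {x..} \<inter> space \<mu>"
      moreover have "Arg2pi z / (2 * pi) \<in> {0..<1}"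
        using Arg2pi[of z] by (auto simp: field_simps)
      ultimately have "Arg2pi z / (2 * pi) \<in> {y..<1}"
        by (auto simp: y_def)
      then show "z \<in> circle_cover ` {y..<1}"
        using circle_cover_Arg2pi[of z] z space by (metis IntD2 imageI)
    next
      fix z assume "z \<in> circle_cover ` {y..<1}"
      then obtain u where u: "z = circle_cover u" "y \<le> u" "u < 1" by auto
      then have "frac u = u"
        by (simp add: frac_eq y_def)
      then have "Arg2pi z / (2 * pi) = u"
        by (simp add: u(1) Arg2pi_circle_cover)
      moreover have "x \<le> u"
        using u by (auto simp: y_def)
      ultimately show "z \<in> (\<lambda>z. Arg2pi z / (2 * pi)) -` {x..} \<inter> space \<mu>"
        using circle_cover_arc_subset[of "{u}"] u(1) space by simp
    qed
    then have "emeasure ?M {x..} = emeasure \<mu> (circle_cover ` {y..<1})"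
      using Arg_meas by (simp add: emeasure_distr)
    also have "\<dots> = ennreal (\<Gamma> 1 - \<Gamma> y)"
      unfolding emeasure_eq_measure invariant_prob_arc[OF f conj irrational inv y] ..
    finally show ?thesis
      unfolding y_def .
  qed
  then show "emeasure ?M {x..} < \<infinity>" for x
    by simp
  show "emeasure ?M {x..} = emeasure ?N {x..}" for x
  proof -
    define y where "y = max 0 (min x 1)"
    have "emeasure ?N {x..} = (\<integral>\<^sup>+t. ennreal (deriv \<Gamma> t) * indicator {0..<1} t * indicator {x..} t \<partial>lborel)"
      by (intro emeasure_density) auto
    also have "\<dots> = (\<integral>\<^sup>+t. ennreal (deriv \<Gamma> t) * indicator {y..1} t \<partial>lborel)"
      \<comment> \<open>The point \<open>1\<close> is null, so the half-open interval may be closed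
        before integrating the derivative.\<close>
      using AE_lborel_singleton[of "1::real"]
      by (intro nn_integral_cong_AE, eventually_elim) (auto simp: y_def split: split_indicator)
    also have "\<dots> = ennreal (\<Gamma> 1 - \<Gamma> y)"
      by (intro nn_integral_FTC_Icc \<Gamma>'(1) less_imp_le[OF \<Gamma>'(3)]) (auto simp: y_def)
    finally show ?thesis
      unfolding M y_def ..
  qed
qed simp_all

section \<open>The interspike-interval distribution\<close>

lemma lift_displacement_derivative:
  assumes "lift_circle_diffeo f"
  shows "(displacement f has_real_derivative deriv f x - 1) (at x)"
    and "deriv (displacement f) x = deriv f x - 1"
    and "continuous_on S (displacement f)"
    and "displacement f 1 = displacement f 0"
proof -
  show D: "(displacement f has_real_derivative deriv f x - 1) (at x)" for x
    unfolding displacement_def[abs_def]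
    by (intro DERIV_diff DERIV_ident lift_circle_diffeo_derivative(1) assms)
  then show "deriv (displacement f) x = deriv f x - 1"
    by (rule DERIV_imp_deriv)
  show "continuous_on S (displacement f)"
    by (rule DERIV_continuous_on) (rule has_field_derivative_at_within[OF D])
  show "displacement f 1 = displacement f 0"
    using assms by (simp add: lift_circle_diffeo_def displacement_def)
       (metis add_0 add_diff_cancel_right')
qed

text \<open>Compactness is wanted for Borel measurability, here and, through the continuous image,
  for the critical values.\<close>

lemma compact_critical_points:
  assumes "lift_circle_diffeo f"
  shows "compact (critical_points f)"
proof -
  have "continuous_on {0..1} (\<lambda>t. deriv f t - 1)"
    by (intro continuous_intros continuous_on_subset[OF lift_circle_diffeo_derivative(2)[OF assms]]) auto
  then have "closed ({0..1} \<inter> (\<lambda>t. deriv f t - 1) -` {0})"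
    by (intro continuous_closed_preimage) auto
  moreover have "critical_points f = {0..1} \<inter> (\<lambda>t. deriv f t - 1) -` {0}"
    unfolding critical_points_def lift_displacement_derivative(2)[OF assms] by auto
  ultimately show ?thesis
    by (simp add: compact_eq_bounded_closed bounded_Int)
qed

lemma compact_critical_values:
  assumes "lift_circle_diffeo f"
  shows "compact (critical_values f)"
  unfolding critical_values_def
  by (intro compact_continuous_image compact_critical_points lift_displacement_derivative(3) assms)

text \<open>Differentiable maps of the line send null sets to null sets; being Borel, the image is
  then null for \<open>lborel\<close> and not only for its completion.\<close>

lemma critical_values_null:
  assumes f: "lift_circle_diffeo f" and null: "critical_points f \<in> null_sets lebesgue"
  shows "critical_values f \<in> null_sets lborel"
proof -
  have "displacement f differentiable_on critical_points f"
    unfolding differentiable_on_def using lift_displacement_derivative(1)[OF f]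
    by (meson differentiable_at_withinI real_differentiable_def)
  moreover have "negligible (critical_points f)"
    using null by (simp add: negligible_iff_null_sets)
  ultimately have "negligible (critical_values f)"
    unfolding critical_values_def by (intro negligible_differentiable_image_negligible) auto
  moreover have "critical_values f \<in> sets borel"
    by (rule borel_compact[OF compact_critical_values[OF f]])
  ultimately show ?thesis
    by (simp add: negligible_iff_null_sets null_sets_completion_iff)
qed

text \<open>The complement is the union of all open null sets. Closedness makes the support
  Borel.\<close>

lemma closed_measure_support: "closed (measure_support \<nu>)"
proof -
  have "- measure_support \<nu> = \<Union>{U. open U \<and> emeasure \<nu> U = 0}"
    by (auto simp: measure_support_def zero_less_iff_neq_zero)
  then show ?thesis
    unfolding closed_def by (metis (no_types, lifting) mem_Collect_eq open_Union)
qed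

text \<open>The fibre is compact. If it were infinite, difference quotients at an accumulation point
  would vanish along the fibre, contradicting the nonzero derivative there.\<close>

lemma finite_displacement_preimage:
  assumes f: "lift_circle_diffeo f" and y: "y \<notin> critical_values f"
  shows "finite (displacement_preimage f y)"
    and "t \<in> displacement_preimage f y \<Longrightarrow> deriv f t \<noteq> 1"
proof -
  note \<Psi> = lift_displacement_derivative[OF f]
  have nz: "deriv f t \<noteq> 1" if "t \<in> displacement_preimage f y" for t
    using that y \<Psi>(2) by (auto simp: critical_values_def critical_points_def displacement_preimage_def)
  then show "t \<in> displacement_preimage f y \<Longrightarrow> deriv f t \<noteq> 1" .
  have "closed ({0..1} \<inter> displacement f -` {y})"
    by (intro continuous_closed_preimage \<Psi>(3)) auto
  moreover have "displacement_preimage f y = {0..1} \<inter> displacement f -` {y}"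
    by (auto simp: displacement_preimage_def)
  ultimately have compact: "compact (displacement_preimage f y)"
    by (simp add: compact_eq_bounded_closed bounded_Int)
  show "finite (displacement_preimage f y)"
  proof (rule ccontr)
    assume "infinite (displacement_preimage f y)"
    then obtain t where t: "t \<in> displacement_preimage f y" "t islimpt displacement_preimage f y"
      using compact unfolding compact_eq_Bolzano_Weierstrass by blast
    have "((\<lambda>s. (displacement f s - displacement f t) / (s - t)) \<longlongrightarrow> deriv f t - 1) (at t)"
      using \<Psi>(1) by (simp add: has_field_derivative_iff)
    then have "\<forall>\<^sub>F s in at t. (displacement f s - displacement f t) / (s - t) \<noteq> 0"
      using nz[OF t(1)] by (intro tendsto_imp_eventually_ne) auto
    then have "\<forall>\<^sub>F s in at t. s \<notin> displacement_preimage f y"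
      by eventually_elim (use t(1) in \<open>auto simp: displacement_preimage_def\<close>)
    then show False
      using t(2) by (simp add: islimpt_iff_eventually)
  qed
qed

section \<open>The distribution as an image measure, its support and its density\<close>

lemma isi_distribution_eq_distr_density:
  assumes f: "lift_circle_diffeo f" and conj: "conjugated_with_translation_via f \<rho> \<Gamma>"
    and irrational: "\<rho> \<notin> \<rat>" and inv: "invariant_prob (circle_map f) \<mu>"
  shows "isi_distribution f \<mu> =
         distr (density lborel (\<lambda>t. ennreal (deriv \<Gamma> t) * indicator {0..<1} t)) borel (displacement f)"
proof (rule measure_eqI)
  have [simp]: "sets (isi_distribution f \<mu>) = sets borel" "space (isi_distribution f \<mu>) = UNIV"
    unfolding isi_distribution_def
    using sets.sigma_sets_eq[of borel] by (simp_all add: sets_measure_of_conv space_measure_of_conv)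
  then show "sets (isi_distribution f \<mu>) = sets (distr (density lborel (\<lambda>t. ennreal (deriv \<Gamma> t) * indicator {0..<1} t)) borel (displacement f))"
    by simp
  have sets: "sets \<mu> = sets circle_borel"
    using inv by (auto simp: invariant_prob_def)
  have space: "space \<mu> = sphere 0 1"
    by (rule space_circle_borel[OF sets])
  have lift: "\<And>t. f (t + 1) = f t + 1"
    using f by (auto simp: lift_circle_diffeo_def)
  have [measurable]: "displacement f \<in> borel_measurable borel"
    by (intro borel_measurable_continuous_onI lift_displacement_derivative f)
  have [measurable]: "(\<lambda>z. Arg2pi z / (2 * pi)) \<in> borel_measurable \<mu>"
    by (rule measurable_Arg2pi_circle_borel[OF sets])
  fix A assume "A \<in> sets (isi_distribution f \<mu>)"
  then have A [measurable]: "A \<in> sets borel" by simp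
  have "emeasure (isi_distribution f \<mu>) A =
      emeasure \<mu> ((\<lambda>z. displacement f (Arg2pi z / (2 * pi))) -` A \<inter> space \<mu>)"
    unfolding emeasure_isi_distribution[OF f sets A] circle_cover_image_displacement[of f, OF lift] space ..
  also have "\<dots> = emeasure (distr (distr \<mu> borel (\<lambda>z. Arg2pi z / (2 * pi))) borel (displacement f)) A"
    by (subst distr_distr) (simp_all add: emeasure_distr comp_def)
  finally show "emeasure (isi_distribution f \<mu>) A = emeasure (distr (density lborel (\<lambda>t. ennreal (deriv \<Gamma> t) * indicator {0..<1} t)) borel (displacement f)) A"
    unfolding distr_Arg2pi_invariant_prob[OF f conj irrational inv] .
qed

lemma emeasure_isi_distribution_integral:
  assumes f: "lift_circle_diffeo f" and conj: "conjugated_with_translation_via f \<rho> \<Gamma>"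
    and irrational: "\<rho> \<notin> \<rat>" and inv: "invariant_prob (circle_map f) \<mu>"
    and A: "A \<in> sets borel"
  shows "emeasure (isi_distribution f \<mu>) A =
    (\<integral>\<^sup>+t. ennreal (deriv \<Gamma> t) * indicator {0..<1} t * indicator (displacement f -` A) t \<partial>lborel)"
proof -
  have "lift_circle_diffeo \<Gamma>"
    using conj by (simp add: conjugated_with_translation_via_def)
  then have [measurable]: "deriv \<Gamma> \<in> borel_measurable borel"
    by (intro borel_measurable_continuous_onI lift_circle_diffeo_derivative)
  have [measurable]: "displacement f \<in> borel_measurable borel"
    by (intro borel_measurable_continuous_onI lift_displacement_derivative f)
  have "displacement f -` A \<in> sets borel"
    by (rule measurable_sets_borel[OF _ A]) measurable
  then show ?thesis
    unfolding isi_distribution_eq_distr_density[OF f conj irrational inv]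
    by (subst emeasure_distr[OF _ A]) (simp_all add: emeasure_density)
qed

text \<open>Since \<open>\<Gamma>\<close> is strictly increasing, every nondegenerate interval
  inside \<open>[0,1]\<close> has positive mass \<open>\<Gamma> b - \<Gamma> a\<close>. Consequently
  fibres over points outside the support are empty.\<close>

lemma displacement_in_support_isi_distribution:
  assumes f: "lift_circle_diffeo f" and conj: "conjugated_with_translation_via f \<rho> \<Gamma>"
    and irrational: "\<rho> \<notin> \<rat>" and inv: "invariant_prob (circle_map f) \<mu>"
    and t: "t \<in> {0..1}"
  shows "displacement f t \<in> measure_support (isi_distribution f \<mu>)"
  unfolding measure_support_def mem_Collect_eq
proof (intro allI impI)
  fix U assume U: "open U" "displacement f t \<in> U"
  note \<Psi> = lift_displacement_derivative[OF f]
  have \<Gamma>: "lift_circle_diffeo \<Gamma>"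
    using conj by (simp add: conjugated_with_translation_via_def)
  note \<Gamma>' = lift_circle_diffeo_derivative[OF \<Gamma>]
  have [measurable]: "deriv \<Gamma> \<in> borel_measurable borel"
    by (rule borel_measurable_continuous_onI[OF \<Gamma>'(2)])
  have "open (displacement f -` U)"
    using \<Psi>(3) U(1) by (simp add: open_vimage continuous_on_eq_continuous_at)
  then obtain e where e: "0 < e" "ball t e \<subseteq> displacement f -` U"
    using U(2) by (meson openE vimageI2)
  \<comment> \<open>Half the radius fits a closed interval into the ball; clipping it to
    \<open>[0,1]\<close> leaves it nondegenerate even when \<open>t\<close> is an endpoint.\<close>
  define a b where "a = max 0 (t - e / 2)" and "b = min 1 (t + e / 2)"
  have ab: "a < b" "0 \<le> a" "b \<le> 1" "{a..b} \<subseteq> ball t e"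
    using e(1) t by (auto simp: a_def b_def dist_real_def)
  have "0 < ennreal (\<Gamma> b - \<Gamma> a)"
    using \<open>a < b\<close> \<Gamma> by (simp add: lift_circle_diffeo_def strict_mono_less)
  also have "\<dots> = (\<integral>\<^sup>+s. ennreal (deriv \<Gamma> s) * indicator {a..b} s \<partial>lborel)"
    using \<open>a < b\<close> by (intro nn_integral_FTC_Icc[symmetric] \<Gamma>'(1) less_imp_le[OF \<Gamma>'(3)]) auto
  also have "\<dots> \<le> (\<integral>\<^sup>+s. ennreal (deriv \<Gamma> s) * indicator {0..<1} s * indicator (displacement f -` U) s \<partial>lborel)"
    using AE_lborel_singleton[of "1::real"]
  proof (intro nn_integral_mono_AE, eventually_elim)
    fix s :: real assume "s \<noteq> 1"
    then have "s \<in> {a..b} \<Longrightarrow> s \<in> {0..<1} \<inter> displacement f -` U"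
      using ab e(2) by auto
    then show "ennreal (deriv \<Gamma> s) * indicator {a..b} s \<le>
        ennreal (deriv \<Gamma> s) * indicator {0..<1} s * indicator (displacement f -` U) s"
      by (auto split: split_indicator)
  qed
  also have "\<dots> = emeasure (isi_distribution f \<mu>) U"
    using U(1) by (simp add: emeasure_isi_distribution_integral[OF f conj irrational inv])
  finally show "0 < emeasure (isi_distribution f \<mu>) U" .
qed

text \<open>The area formula is applied to the displacement on its regular points. Null sets are
  discarded twice: critical points and endpoints before the change of variables, critical values and
  the common endpoint value after it.\<close>

lemma isi_distribution_density:
  assumes f: "lift_circle_diffeo f" and conj: "conjugated_with_translation_via f \<rho> \<Gamma>"
    and irrational: "\<rho> \<notin> \<rat>" and inv: "invariant_prob (circle_map f) \<mu>"
    and null: "critical_points f \<in> null_sets lebesgue"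
  shows "isi_density f \<Gamma> \<mu> \<in> borel_measurable borel"
    and "isi_distribution f \<mu> = density lborel (\<lambda>y. ennreal (isi_density f \<Gamma> \<mu> y))"
proof -
  note \<Psi> = lift_displacement_derivative[OF f]
  have \<Gamma>: "lift_circle_diffeo \<Gamma>"
    using conj by (simp add: conjugated_with_translation_via_def)
  note \<Gamma>' = lift_circle_diffeo_derivative[OF \<Gamma>] and f' = lift_circle_diffeo_derivative[OF f]
  have [measurable]: "deriv \<Gamma> \<in> borel_measurable borel"
    by (rule borel_measurable_continuous_onI[OF \<Gamma>'(2)])
  have [measurable]: "deriv f \<in> borel_measurable borel"
    by (rule borel_measurable_continuous_onI[OF f'(2)])
  have [measurable]: "displacement f \<in> borel_measurable borel"
    by (intro borel_measurable_continuous_onI \<Psi>)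
  \<comment> \<open>The factor produced by the area formula cancels the denominator and leaves
    \<open>deriv \<Gamma>\<close>. At critical points division by zero makes \<open>w\<close> equal
    to \<open>0\<close>, which is harmless as \<open>S\<close> omits them.\<close>
  define w where "w = (\<lambda>t. deriv \<Gamma> t * (1 / \<bar>deriv f t - 1\<bar>))"
  \<comment> \<open>The area formula needs an open set; only endpoints and critical points of the
    unit interval are lost.\<close>
  define S where "S = {t \<in> {0<..<1}. deriv f t - 1 \<noteq> 0}"
  define D where "D = (\<lambda>y. \<integral>\<^sup>+t. ennreal (w t) * indicator {t \<in> S. displacement f t = y} t \<partial>count_space UNIV)"
  have [measurable]: "w \<in> borel_measurable borel"
    unfolding w_def by measurable
  have w_nonneg: "0 \<le> w t" for t
    unfolding w_def using \<Gamma>'(3)[of t] by simp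
  have S_cont: "continuous_on T (\<lambda>t. deriv f t - 1)" for T
    by (intro continuous_intros continuous_on_subset[OF f'(2)]) auto
  have "open S"
  proof -
    have "S = {0<..<1} \<inter> (\<lambda>t. deriv f t - 1) -` (- {0})"
      by (auto simp: S_def)
    moreover have "open ({0<..<1} \<inter> (\<lambda>t. deriv f t - 1) -` (- {0}))"
      by (intro continuous_open_preimage S_cont) auto
    ultimately show ?thesis by simp
  qed
  then have [measurable]: "S \<in> sets borel" by simp
  have area: "(\<lambda>y. \<integral>\<^sup>+t. k t * indicator {t \<in> S. displacement f t = y} t \<partial>count_space UNIV) \<in> borel_measurable borel"
    "(\<integral>\<^sup>+t. k t * ennreal \<bar>deriv f t - 1\<bar> * indicator S t \<partial>lborel) =
     (\<integral>\<^sup>+y. (\<integral>\<^sup>+t. k t * indicator {t \<in> S. displacement f t = y} t \<partial>count_space UNIV) \<partial>lborel)"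
    if "k \<in> borel_measurable borel" for k :: "real \<Rightarrow> ennreal"
    using nn_integral_area[OF that \<open>open S\<close> \<Psi>(1) S_cont] by (auto simp: S_def)
  have D_meas [measurable]: "D \<in> borel_measurable borel"
    unfolding D_def by (rule area) measurable
  \<comment> \<open>The displacement agrees at \<open>0\<close> and \<open>1\<close>, and the fibre
    over this common value contains endpoints that \<open>S\<close> lacks. One extra point keeps the
    exceptional set null.\<close>
  define V where "V = insert (displacement f 0) (critical_values f)"
  have D_eq: "ennreal (isi_density f \<Gamma> \<mu> y) = D y" "isi_density f \<Gamma> \<mu> y = enn2real (D y)" if "y \<notin> V" for y
  proof -
    have y: "y \<notin> critical_values f" "y \<noteq> displacement f 0"
      using that by (auto simp: V_def)
    note fin = finite_displacement_preimage[OF f y(1)]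
    have "{t \<in> S. displacement f t = y} = displacement_preimage f y"
      using fin(2) y(2) \<Psi>(4) by (auto simp: S_def displacement_preimage_def order_less_le)
    then have "D y = (\<Sum>t\<in>displacement_preimage f y. ennreal (w t))"
      unfolding D_def using fin(1)
      by (subst nn_integral_count_space'[of "displacement_preimage f y"]) auto
    also have "\<dots> = ennreal (\<Sum>t\<in>displacement_preimage f y. w t)"
      by (rule sum_ennreal) (rule w_nonneg)
    also have "(\<Sum>t\<in>displacement_preimage f y. w t) = isi_density f \<Gamma> \<mu> y"
    proof (cases "y \<in> measure_support (isi_distribution f \<mu>)")
      case True
      with y show ?thesis by (simp add: isi_density_def w_def)
    next
      case False
      \<comment> \<open>All values taken on \<open>[0,1]\<close> lie in the support, so off the
        support the fibre sum is empty and agrees with the prescribed \<open>0\<close>.\<close>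
      then have "displacement_preimage f y = {}"
        using displacement_in_support_isi_distribution[OF f conj irrational inv]
        by (auto simp: displacement_preimage_def)
      with False show ?thesis by (simp add: isi_density_def)
    qed
    finally show "ennreal (isi_density f \<Gamma> \<mu> y) = D y" ..
    moreover have "0 \<le> isi_density f \<Gamma> \<mu> y"
      unfolding isi_density_def using w_nonneg by (auto simp: w_def intro: sum_nonneg)
    ultimately show "isi_density f \<Gamma> \<mu> y = enn2real (D y)"
      by (metis enn2real_ennreal)
  qed
  have V_null: "V \<in> null_sets lborel"
    unfolding V_def using critical_values_null[OF f null]
    by (metis insert_is_Un finite_imp_null_set_lborel finite.intros null_sets.Un)
  have [measurable]: "critical_values f \<in> sets borel"
    by (rule borel_compact[OF compact_critical_values[OF f]])
  \<comment> \<open>Agreement with \<open>D\<close> off \<open>V\<close> does not settle Borel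
    measurability on \<open>V\<close>; there the density is \<open>0\<close> on the critical values,
    and at most one further value remains.\<close>
  have "isi_density f \<Gamma> \<mu> = (\<lambda>y. if y \<in> critical_values f then 0
      else if y = displacement f 0 then isi_density f \<Gamma> \<mu> (displacement f 0) else enn2real (D y))"
    using D_eq(2) by (auto simp: V_def fun_eq_iff isi_density_def)
  moreover have "\<dots> \<in> borel_measurable borel"
    by measurable
  ultimately show meas [measurable]: "isi_density f \<Gamma> \<mu> \<in> borel_measurable borel"
    by simp
  show "isi_distribution f \<mu> = density lborel (\<lambda>y. ennreal (isi_density f \<Gamma> \<mu> y))"
  proof (rule measure_eqI)
    show sets: "sets (isi_distribution f \<mu>) = sets (density lborel (\<lambda>y. ennreal (isi_density f \<Gamma> \<mu> y)))"
      unfolding isi_distribution_eq_distr_density[OF f conj irrational inv] by simp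
    fix A assume "A \<in> sets (isi_distribution f \<mu>)"
    then have [measurable]: "A \<in> sets borel"
      unfolding sets by simp
    have null': "critical_points f \<in> null_sets lborel"
      using null borel_compact[OF compact_critical_points[OF f]]
      by (simp add: null_sets_completion_iff)
    have "emeasure (isi_distribution f \<mu>) A =
        (\<integral>\<^sup>+t. ennreal (deriv \<Gamma> t) * indicator {0..<1} t * indicator (displacement f -` A) t \<partial>lborel)"
      by (rule emeasure_isi_distribution_integral[OF f conj irrational inv]) measurable
    \<comment> \<open>The integrands differ at most at critical points and at \<open>0\<close>,
      because \<open>1\<close> is already outside \<open>{0..<1}\<close>.\<close>
    also have "\<dots> = (\<integral>\<^sup>+t. ennreal (w t) * indicator (displacement f -` A) t * ennreal \<bar>deriv f t - 1\<bar> * indicator S t \<partial>lborel)"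
      using AE_not_in[OF null'] AE_lborel_singleton[of "0::real"]
    proof (intro nn_integral_cong_AE, eventually_elim)
      fix t assume t: "t \<notin> critical_points f" "t \<noteq> 0"
      show "ennreal (deriv \<Gamma> t) * indicator {0..<1} t * indicator (displacement f -` A) t =
          ennreal (w t) * indicator (displacement f -` A) t * ennreal \<bar>deriv f t - 1\<bar> * indicator S t"
      proof (cases "t \<in> S")
        case True
        then have "ennreal (deriv \<Gamma> t) = ennreal (w t) * ennreal \<bar>deriv f t - 1\<bar>"
          using w_nonneg[of t] by (simp add: ennreal_mult[symmetric] w_def S_def)
        with True show ?thesis
          by (auto simp: S_def split: split_indicator)
      next
        case False
        with t have "t \<notin> {0..<1}"
          by (auto simp: S_def critical_points_def \<Psi>(2))
        with False show ?thesis by simp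
      qed
    qed
    also have "\<dots> = (\<integral>\<^sup>+y. (\<integral>\<^sup>+t. ennreal (w t) * indicator (displacement f -` A) t *
        indicator {t \<in> S. displacement f t = y} t \<partial>count_space UNIV) \<partial>lborel)"
    proof (rule area(2))
      have "displacement f -` A \<in> sets borel"
        by (rule measurable_sets_borel) measurable
      then show "(\<lambda>t. ennreal (w t) * indicator (displacement f -` A) t) \<in> borel_measurable borel"
        by measurable
    qed
    \<comment> \<open>On the fibre over \<open>y\<close> the condition
      \<open>displacement f t \<in> A\<close> reads \<open>y \<in> A\<close>, so its indicator
      leaves the counting integral.\<close>
    also have "\<dots> = (\<integral>\<^sup>+y. D y * indicator A y \<partial>lborel)"
    proof (intro nn_integral_cong)
      fix y
      have "(\<integral>\<^sup>+t. ennreal (w t) * indicator (displacement f -` A) t * indicator {t \<in> S. displacement f t = y} t \<partial>count_space UNIV)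
          = (\<integral>\<^sup>+t. ennreal (w t) * indicator {t \<in> S. displacement f t = y} t * indicator A y \<partial>count_space UNIV)"
        by (intro nn_integral_cong) (auto split: split_indicator)
      also have "\<dots> = D y * indicator A y"
        unfolding D_def by (rule nn_integral_multc) simp
      finally show "(\<integral>\<^sup>+t. ennreal (w t) * indicator (displacement f -` A) t * indicator {t \<in> S. displacement f t = y} t \<partial>count_space UNIV) = D y * indicator A y" .
    qed
    also have "\<dots> = (\<integral>\<^sup>+y. ennreal (isi_density f \<Gamma> \<mu> y) * indicator A y \<partial>lborel)"
      using AE_not_in[OF V_null]
      by (intro nn_integral_cong_AE, eventually_elim) (simp add: D_eq(1))
    also have "\<dots> = emeasure (density lborel (\<lambda>y. ennreal (isi_density f \<Gamma> \<mu> y))) A"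
      by (rule emeasure_density[symmetric]) auto
    finally show "emeasure (isi_distribution f \<mu>) A = emeasure (density lborel (\<lambda>y. ennreal (isi_density f \<Gamma> \<mu> y))) A" .
  qed
qed

text \<open>The last two conjuncts make precise that the sum is well-defined almost everywhere in
  the support: off a null set it is a finite sum with nonzero denominators.\<close>

theorem theorem3p18:
  fixes F :: "real \<Rightarrow> real \<Rightarrow> real"
    and \<Phi> \<Gamma> :: "real \<Rightarrow> real"
    and \<rho> :: real
    and \<mu> :: "complex measure"
  assumes well_posed: "well_posed F"
    and periodic: "\<And>t x. F (t + 1) x = F t x"
    and fires: "\<And>t. firing_times F t \<noteq> {}"
    and firing_map: "\<Phi> = firing_map F"
    and diffeo: "lift_circle_diffeo \<Phi>"
    and rotation: "has_rotation_number \<Phi> \<rho>"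
    and irrational: "\<rho> \<notin> \<rat>"
    and conjugacy: "conjugated_with_translation_via \<Phi> \<rho> \<Gamma>"
    and invariant: "invariant_prob (circle_map \<Phi>) \<mu>"
    and critical: "critical_points \<Phi> \<in> null_sets lebesgue"
  shows "absolutely_continuous lborel (isi_distribution \<Phi> \<mu>)
    \<and> isi_density \<Phi> \<Gamma> \<mu> \<in> borel_measurable lborel
    \<and> isi_distribution \<Phi> \<mu> = density lborel (\<lambda>y. ennreal (isi_density \<Phi> \<Gamma> \<mu> y))
    \<and> measure_support (isi_distribution \<Phi> \<mu>) \<inter> critical_values \<Phi> \<in> null_sets lborel
    \<and> (\<forall>y \<in> measure_support (isi_distribution \<Phi> \<mu>) - critical_values \<Phi>.
         finite (displacement_preimage \<Phi> y) \<and>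
         (\<forall>t \<in> displacement_preimage \<Phi> y. deriv \<Phi> t \<noteq> 1))"
proof -
  note density = isi_distribution_density[OF diffeo conjugacy irrational invariant critical]
  have "absolutely_continuous lborel (isi_distribution \<Phi> \<mu>)"
    unfolding density(2) by (rule absolutely_continuousI_density) (use density(1) in simp)
  moreover have "measure_support (isi_distribution \<Phi> \<mu>) \<inter> critical_values \<Phi> \<in> null_sets lborel"
    using critical_values_null[OF diffeo critical] closed_measure_support[of "isi_distribution \<Phi> \<mu>"]
    by (intro null_set_Int1) auto
  ultimately show ?thesis
    using density finite_displacement_preimage[OF diffeo] by auto
qed

end
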